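(* Let $\mathbb{QU}$ be the rational Urysohn universal metric space. For any finite subset $F\subset \mathbb{QU}$, with the induced metric and with isometry group $G=\mathrm{ISO}(F)$, there exists an injective group homomorphism $j:G\to \mathrm{ISO}(\mathbb{QU})$ such that $(j(g))(f)=g(f)$ for all $g\in G$ and all $f\in F$. Consequently, $\mathbb{QU}$ is a countable union of finite orbits of the group $j(G)$.
   Context: For a metric space $X$, $\mathrm{ISO}(X)$ denotes the group of all isometries of $X$ onto itself. The rational Urysohn universal space $\mathbb{QU}$ is the (unique up to isometry) countable metric space with rational distances that contains an isometric copy of every finite metric space with rational distances and is ultrahomogeneous: every isometry between two finite subsets of $\mathbb{QU}$ extends to an isometry of $\mathbb{QU}$ onto itself. *)

theory Defs
  imports
    "HOL-Analysis.Abstract_Metric_Spaces"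
    "HOL-Algebra.Group_Action"
begin

definition isometric_on ::
  "'a set \<Rightarrow> ('a \<Rightarrow> 'a \<Rightarrow> real) \<Rightarrow> ('b \<Rightarrow> 'b \<Rightarrow> real) \<Rightarrow> ('a \<Rightarrow> 'b) \<Rightarrow> bool"
  where "isometric_on X d d' f \<longleftrightarrow> (\<forall>x\<in>X. \<forall>y\<in>X. d' (f x) (f y) = d x y)"

text \<open>As in \<^const>\<open>BijGroup\<close>, the elements are extensional functions, so that distinct group
  elements differ at some point of the carrier set.\<close>

definition isometry_group :: "'a set \<Rightarrow> ('a \<Rightarrow> 'a \<Rightarrow> real) \<Rightarrow> ('a \<Rightarrow> 'a) monoid"
  where "isometry_group X d = (BijGroup X)\<lparr>carrier := {f \<in> Bij X. isometric_on X d d f}\<rparr>"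

lemma subgroup_isometries: "subgroup {f \<in> Bij X. isometric_on X d d f} (BijGroup X)"
proof -
  interpret B: group "BijGroup X" by (rule group_BijGroup)
  show ?thesis
  proof (rule B.subgroupI)
    show "{f \<in> Bij X. isometric_on X d d f} \<subseteq> carrier (BijGroup X)"
      by (auto simp: BijGroup_def)
    have "(\<lambda>x\<in>X. x) \<in> {f \<in> Bij X. isometric_on X d d f}"
      by (auto simp: id_Bij isometric_on_def)
    then show "{f \<in> Bij X. isometric_on X d d f} \<noteq> {}"
      by blast
  next
    fix f assume f: "f \<in> {f \<in> Bij X. isometric_on X d d f}"
    then have bij: "bij_betw f X X" by (simp add: Bij_def)
    have "isometric_on X d d (\<lambda>x\<in>X. inv_into X f x)"
      unfolding isometric_on_def
    proof (intro ballI)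
      fix x y assume xy: "x \<in> X" "y \<in> X"
      then have "inv_into X f x \<in> X" "inv_into X f y \<in> X"
        using bij by (metis bij_betw_def inv_into_into)+
      then have "d (f (inv_into X f x)) (f (inv_into X f y)) = d (inv_into X f x) (inv_into X f y)"
        using f by (simp add: isometric_on_def)
      then show "d ((\<lambda>x\<in>X. inv_into X f x) x) ((\<lambda>x\<in>X. inv_into X f x) y) = d x y"
        using xy bij by (simp add: bij_betw_inv_into_right)
    qed
    then show "inv\<^bsub>BijGroup X\<^esub> f \<in> {f \<in> Bij X. isometric_on X d d f}"
      using f by (simp add: inv_BijGroup restrict_inv_into_Bij)
  next
    fix f g
    assume "f \<in> {f \<in> Bij X. isometric_on X d d f}" "g \<in> {f \<in> Bij X. isometric_on X d d f}"
    then show "f \<otimes>\<^bsub>BijGroup X\<^esub> g \<in> {f \<in> Bij X. isometric_on X d d f}"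
      using Bij_imp_funcset[of g X]
      by (auto simp: BijGroup_def compose_Bij isometric_on_def compose_eq Pi_iff)
  qed
qed

lemma group_isometry_group: "group (isometry_group X d)"
  unfolding isometry_group_def
  using group.subgroup_imp_group[OF group_BijGroup subgroup_isometries] .

text \<open>A locale assumption cannot quantify over types. In \<open>universal\<close> it suffices to consider
  finite metric spaces of natural numbers: every finite metric space is isometric to one of
  these (see \<open>universal_any_type\<close> below).\<close>

locale rational_urysohn = Metric_space M d
  for M :: "'a set" and d :: "'a \<Rightarrow> 'a \<Rightarrow> real" +
  assumes countable: "countable M"
    and rational: "\<And>x y. \<lbrakk>x \<in> M; y \<in> M\<rbrakk> \<Longrightarrow> d x y \<in> \<rat>"
    and universal: "\<And>(X :: nat set) dX.
      \<lbrakk>Metric_space X dX; finite X; \<And>x y. \<lbrakk>x \<in> X; y \<in> X\<rbrakk> \<Longrightarrow> dX x y \<in> \<rat>\<rbrakk>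
      \<Longrightarrow> \<exists>i. i \<in> X \<rightarrow> M \<and> isometric_on X dX d i"
    and ultrahomogeneous: "\<And>A B f.
      \<lbrakk>A \<subseteq> M; B \<subseteq> M; finite A; finite B; f ` A = B; isometric_on A d d f\<rbrakk>
      \<Longrightarrow> \<exists>g \<in> carrier (isometry_group M d). \<forall>x\<in>A. g x = f x"

lemma (in rational_urysohn) universal_any_type:
  fixes X :: "'b set"
  assumes X: "Metric_space X dX" "finite X" "\<And>x y. \<lbrakk>x \<in> X; y \<in> X\<rbrakk> \<Longrightarrow> dX x y \<in> \<rat>"
  shows "\<exists>i. i \<in> X \<rightarrow> M \<and> isometric_on X dX d i"
proof -
  interpret X: Metric_space X dX by fact
  obtain e :: "'b \<Rightarrow> nat" where e: "inj_on e X"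
    using finite_imp_inj_to_nat_seg[OF X(2)] by blast
  let ?r = "inv_into X e"
  have r: "?r n \<in> X" if "n \<in> e ` X" for n
    using that by (rule inv_into_into)
  have "Metric_space (e ` X) (\<lambda>m n. dX (?r m) (?r n))"
  proof
    show "dX (?r m) (?r n) = dX (?r n) (?r m)" for m n
      by (rule X.commute)
    show "dX (?r m) (?r n) = 0 \<longleftrightarrow> m = n" if "m \<in> e ` X" "n \<in> e ` X" for m n
      using that e by auto
    show "dX (?r l) (?r n) \<le> dX (?r l) (?r m) + dX (?r m) (?r n)"
      if "l \<in> e ` X" "m \<in> e ` X" "n \<in> e ` X" for l m n
      using that r by (intro X.triangle) auto
  qed simp
  then obtain i where "i \<in> e ` X \<rightarrow> M"
    "isometric_on (e ` X) (\<lambda>m n. dX (?r m) (?r n)) d i"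
    using universal[of "e ` X"] X r by blast
  then have "i \<circ> e \<in> X \<rightarrow> M \<and> isometric_on X dX d (i \<circ> e)"
    using e by (auto simp: isometric_on_def)
  then show ?thesis by blast
qed

end

theory Submission
  imports Defs
begin

text \<open>The action of \<open>G = ISO(F)\<close> on \<open>F\<close> is extended to the whole space by adding one point at a
  time. Suppose that \<open>G\<close> acts by isometries on a finite nonempty set \<open>A \<subseteq> M\<close>, and let \<open>x \<in> M - A\<close>.
  The point \<open>x\<close> needs an orbit. For each \<open>g \<in> G\<close> take a new point \<open>gx\<close> at distance
  \<open>d x (g\<^sup>-\<^sup>1 a)\<close> from each \<open>a \<in> A\<close>, which is forced if \<open>g\<close> is to act isometrically; and let two of
  the new points have the largest distance that the triangle inequality allows, the length of the
  shortest path through \<open>A\<close> (\<open>Metric_space_amalgam\<close>). The choice is canonical, so \<open>G\<close> acts by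
  isometries on the finite rational space \<open>A + G\<close>, by left multiplication on the second summand.
  By universality and ultrahomogeneity this space embeds in \<open>M\<close> with \<open>A\<close> fixed and the new point
  of the unit sent to \<open>x\<close> (\<open>isometric_embedding_extends\<close>). The image is a finite set that
  contains \<open>A\<close> and \<open>x\<close>, and carries an extension of the action (\<open>isometric_action_add_point\<close>).

  As \<open>M\<close> is countable, iterating this along an enumeration gives an increasing sequence of finite
  sets with compatible actions and union \<open>M\<close>, hence an isometric action of \<open>G\<close> on \<open>M\<close>
  (\<open>isometric_action_extends\<close>). Such an action is the same thing as a homomorphism into
  \<open>ISO(M)\<close>. It is injective because \<open>g\<close> is recovered from its values on \<open>F\<close>, and its orbits are
  finite because \<open>G\<close> is finite.\<close>

section \<open>Free amalgams of one-point extensions\<close>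

text \<open>The function \<open>f i\<close> prescribes the distances from a new point \<open>i\<close> to the points of \<open>A\<close>. A path
  between two new points is made to pass through \<open>A\<close>.\<close>

fun amalgam_dist ::
  "'a set \<Rightarrow> ('a \<Rightarrow> 'a \<Rightarrow> real) \<Rightarrow> ('i \<Rightarrow> 'a \<Rightarrow> real) \<Rightarrow> 'a + 'i \<Rightarrow> 'a + 'i \<Rightarrow> real"
where
  "amalgam_dist A d f (Inl a) (Inl b) = d a b"
| "amalgam_dist A d f (Inl a) (Inr i) = f i a"
| "amalgam_dist A d f (Inr i) (Inl a) = f i a"
| "amalgam_dist A d f (Inr i) (Inr j) = (if i = j then 0 else MIN a\<in>A. f i a + f j a)"

text \<open>The hypotheses \<open>lipschitz\<close> and \<open>wide\<close> say that each \<open>f i\<close> is a Katetov function, that is,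
  the triangle inequality holds when a single new point \<open>i\<close> is added to \<open>A\<close>. Two new points cause no further
  conflict: a minimal path between them meets \<open>A\<close> in some \<open>c\<close>, so that a triangle with several
  new points splits into triangles with one. The hypothesis \<open>f_nonneg\<close> ranges over all arguments because
  \<^locale>\<open>Metric_space\<close> demands nonnegativity off the carrier too.\<close>

lemma Metric_space_amalgam:
  assumes "Metric_space A d" and "finite A" and "A \<noteq> {}"
    and f_nonneg: "\<And>i a. 0 \<le> f i a"
    and pos: "\<And>i a. \<lbrakk>i \<in> I; a \<in> A\<rbrakk> \<Longrightarrow> 0 < f i a"
    and lipschitz: "\<And>i a b. \<lbrakk>i \<in> I; a \<in> A; b \<in> A\<rbrakk> \<Longrightarrow> f i a \<le> d a b + f i b"
    and wide: "\<And>i a b. \<lbrakk>i \<in> I; a \<in> A; b \<in> A\<rbrakk> \<Longrightarrow> d a b \<le> f i a + f i b"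
  shows "Metric_space (A <+> I) (amalgam_dist A d f)"
proof -
  interpret Metric_space A d by fact
  define m where "m i j = (MIN a\<in>A. f i a + f j a)" for i j
  have m_le: "m i j \<le> f i a + f j a" if "a \<in> A" for i j a
    unfolding m_def using that \<open>finite A\<close> by simp
  have m_attained: "\<exists>a\<in>A. m i j = f i a + f j a" for i j
  proof -
    have "m i j \<in> (\<lambda>a. f i a + f j a) ` A"
      unfolding m_def using \<open>finite A\<close> \<open>A \<noteq> {}\<close> by (intro Min_in) auto
    then show ?thesis by blast
  qed
  have m_commute: "m i j = m j i" for i j
    by (simp add: m_def add.commute)
  have m_nonneg: "0 \<le> m i j" for i j
    using m_attained[of i j] f_nonneg by (metis add_nonneg_nonneg)
  have m_pos: "0 < m i j" if "i \<in> I" "j \<in> I" for i j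
    using m_attained[of i j] pos that by (metis add_pos_pos)
  have via_new: "f j a \<le> f i a + m i j" if "i \<in> I" "j \<in> I" "a \<in> A" for i j a
  proof -
    obtain c where c: "c \<in> A" "m i j = f i c + f j c" using m_attained by blast
    show ?thesis
      using lipschitz[OF that(2,3) c(1)] wide[OF that(1,3) c(1)] c(2) by linarith
  qed
  have new_triangle: "m i k \<le> m i j + m j k" if "i \<in> I" "j \<in> I" "k \<in> I" for i j k
  proof -
    obtain a where a: "a \<in> A" "m i j = f i a + f j a" using m_attained by blast
    show ?thesis
      using m_le[OF a(1), of i k] via_new[OF that(2,3) a(1)] a(2) by linarith
  qed
  have D [simp]: "amalgam_dist A d f (Inr i) (Inr j) = (if i = j then 0 else m i j)" for i j
    by (simp add: m_def)
  note amalgam_dist.simps(4) [simp del]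
  show ?thesis
  proof
    fix p q
    show "0 \<le> amalgam_dist A d f p q"
      by (cases p; cases q) (simp_all add: nonneg f_nonneg m_nonneg)
    show "amalgam_dist A d f p q = amalgam_dist A d f q p"
      by (cases p; cases q) (simp_all add: commute m_commute)
  next
    fix p q assume "p \<in> A <+> I" "q \<in> A <+> I"
    then show "amalgam_dist A d f p q = 0 \<longleftrightarrow> p = q"
      by (elim PlusE) (auto dest: pos m_pos)
  next
    fix p q r assume "p \<in> A <+> I" "q \<in> A <+> I" "r \<in> A <+> I"
    then show "amalgam_dist A d f p r \<le> amalgam_dist A d f p q + amalgam_dist A d f q r"
    proof (elim PlusE; hypsubst)
      fix a b c assume "a \<in> A" "b \<in> A" "c \<in> A"
      then show "amalgam_dist A d f (Inl a) (Inl c)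
          \<le> amalgam_dist A d f (Inl a) (Inl b) + amalgam_dist A d f (Inl b) (Inl c)"
        by (simp add: triangle)
    next
      fix a b i assume "a \<in> A" "b \<in> A" "i \<in> I"
      then show "amalgam_dist A d f (Inl a) (Inr i)
          \<le> amalgam_dist A d f (Inl a) (Inl b) + amalgam_dist A d f (Inl b) (Inr i)"
        by (simp add: lipschitz)
    next
      fix a i c assume "a \<in> A" "i \<in> I" "c \<in> A"
      then show "amalgam_dist A d f (Inl a) (Inl c)
          \<le> amalgam_dist A d f (Inl a) (Inr i) + amalgam_dist A d f (Inr i) (Inl c)"
        by (simp add: wide)
    next
      fix a i j assume "a \<in> A" "i \<in> I" "j \<in> I"
      then show "amalgam_dist A d f (Inl a) (Inr j)
          \<le> amalgam_dist A d f (Inl a) (Inr i) + amalgam_dist A d f (Inr i) (Inr j)"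
        by (simp add: via_new)
    next
      fix i b c assume "i \<in> I" "b \<in> A" "c \<in> A"
      then show "amalgam_dist A d f (Inr i) (Inl c)
          \<le> amalgam_dist A d f (Inr i) (Inl b) + amalgam_dist A d f (Inl b) (Inl c)"
        using lipschitz[of i c b] by (simp add: commute)
    next
      fix i b k assume "i \<in> I" "b \<in> A" "k \<in> I"
      then show "amalgam_dist A d f (Inr i) (Inr k)
          \<le> amalgam_dist A d f (Inr i) (Inl b) + amalgam_dist A d f (Inl b) (Inr k)"
        by (simp add: f_nonneg m_le)
    next
      fix i j c assume "i \<in> I" "j \<in> I" "c \<in> A"
      then show "amalgam_dist A d f (Inr i) (Inl c)
          \<le> amalgam_dist A d f (Inr i) (Inr j) + amalgam_dist A d f (Inr j) (Inl c)"
        using via_new[of j i c] by (simp add: m_commute)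
    next
      fix i j k assume "i \<in> I" "j \<in> I" "k \<in> I"
      then show "amalgam_dist A d f (Inr i) (Inr k)
          \<le> amalgam_dist A d f (Inr i) (Inr j) + amalgam_dist A d f (Inr j) (Inr k)"
        by (simp add: new_triangle m_nonneg)
    qed
  qed
qed

lemma amalgam_dist_rational:
  assumes "finite A" and "A \<noteq> {}"
    and d: "\<And>a b. \<lbrakk>a \<in> A; b \<in> A\<rbrakk> \<Longrightarrow> d a b \<in> \<rat>"
    and f: "\<And>i a. \<lbrakk>i \<in> I; a \<in> A\<rbrakk> \<Longrightarrow> f i a \<in> \<rat>"
    and "p \<in> A <+> I" and "q \<in> A <+> I"
  shows "amalgam_dist A d f p q \<in> \<rat>"
proof -
  have "(MIN a\<in>A. f i a + f j a) \<in> \<rat>" if "i \<in> I" "j \<in> I" for i j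
  proof -
    have "(MIN a\<in>A. f i a + f j a) \<in> (\<lambda>a. f i a + f j a) ` A"
      using assms(1,2) by (intro Min_in) auto
    then show ?thesis using f that by auto
  qed
  with assms show ?thesis by (elim PlusE) auto
qed

section \<open>Embeddings over a finite subset\<close>

lemma isometric_on_inj_on:
  assumes "Metric_space X d" and "Metric_space Y d'" and "f \<in> X \<rightarrow> Y" and "isometric_on X d d' f"
  shows "inj_on f X"
proof (rule inj_onI)
  fix x y assume "x \<in> X" "y \<in> X" "f x = f y"
  then have "d x y = 0"
    using assms by (metis Metric_space.mdist_zero Pi_iff isometric_on_def)
  then show "x = y"
    using \<open>x \<in> X\<close> \<open>y \<in> X\<close> assms(1) by (simp add: Metric_space.zero)
qed

text \<open>The extension property of the Urysohn space: universality embeds \<open>X\<close> somewhere, and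
  ultrahomogeneity then moves the copy of \<open>S\<close> to the prescribed place.\<close>

lemma (in rational_urysohn) isometric_embedding_extends:
  fixes X :: "'b set"
  assumes X: "Metric_space X dX" "finite X" "\<And>x y. \<lbrakk>x \<in> X; y \<in> X\<rbrakk> \<Longrightarrow> dX x y \<in> \<rat>"
    and "S \<subseteq> X" and f: "f \<in> S \<rightarrow> M" "isometric_on S dX d f"
  shows "\<exists>e. e \<in> X \<rightarrow> M \<and> isometric_on X dX d e \<and> (\<forall>s\<in>S. e s = f s)"
proof -
  obtain i where i: "i \<in> X \<rightarrow> M" "isometric_on X dX d i"
    using universal_any_type[OF X] by blast
  have inj: "inj_on i X"
    using isometric_on_inj_on[OF X(1) Metric_space_axioms i] .
  let ?h = "\<lambda>y. f (inv_into X i y)"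
  have h: "?h (i s) = f s" if "s \<in> S" for s
    using that inj \<open>S \<subseteq> X\<close> by (simp add: subset_iff)
  have "\<exists>k \<in> carrier (isometry_group M d). \<forall>y\<in>i ` S. k y = ?h y"
  proof (rule ultrahomogeneous)
    show "i ` S \<subseteq> M" "?h ` i ` S \<subseteq> M"
      using i(1) f(1) \<open>S \<subseteq> X\<close> h by auto
    show "finite (i ` S)" "finite (?h ` i ` S)"
      using \<open>S \<subseteq> X\<close> \<open>finite X\<close> by (auto dest: finite_subset)
    show "isometric_on (i ` S) d d ?h"
      using f(2) i(2) \<open>S \<subseteq> X\<close> h by (auto simp: isometric_on_def subset_iff)
  qed simp
  then obtain k where k: "k \<in> Bij M" "isometric_on M d d k" "\<And>s. s \<in> S \<Longrightarrow> k (i s) = f s"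
    using h by (auto simp: isometry_group_def)
  have "k \<circ> i \<in> X \<rightarrow> M"
    using i(1) Bij_imp_funcset[OF k(1)] by auto
  moreover have "isometric_on X dX d (k \<circ> i)"
    using i k(2) by (auto simp: isometric_on_def Pi_iff)
  ultimately show ?thesis
    using k(3) by (intro exI[of _ "k \<circ> i"]) simp
qed

section \<open>Isometric actions\<close>

text \<open>The functions \<open>\<alpha> g\<close> are constrained on \<open>A\<close> only and need not be extensional. This lets an
  action on a larger set extend one on \<open>A\<close> by plain equality of values on \<open>A\<close>.\<close>

definition isometric_action ::
  "('g, 'm) monoid_scheme \<Rightarrow> 'a set \<Rightarrow> ('a \<Rightarrow> 'a \<Rightarrow> real) \<Rightarrow> ('g \<Rightarrow> 'a \<Rightarrow> 'a) \<Rightarrow> bool"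
where "isometric_action G A d \<alpha> \<longleftrightarrow>
    (\<forall>g\<in>carrier G. \<alpha> g \<in> A \<rightarrow> A \<and> isometric_on A d d (\<alpha> g))
  \<and> (\<forall>a\<in>A. \<alpha> \<one>\<^bsub>G\<^esub> a = a)
  \<and> (\<forall>g\<in>carrier G. \<forall>h\<in>carrier G. \<forall>a\<in>A. \<alpha> (g \<otimes>\<^bsub>G\<^esub> h) a = \<alpha> g (\<alpha> h a))"

lemma isometric_actionD:
  assumes "isometric_action G A d \<alpha>" and "g \<in> carrier G"
  shows "a \<in> A \<Longrightarrow> \<alpha> g a \<in> A"
    and "\<lbrakk>a \<in> A; b \<in> A\<rbrakk> \<Longrightarrow> d (\<alpha> g a) (\<alpha> g b) = d a b"
    and "\<lbrakk>h \<in> carrier G; a \<in> A\<rbrakk> \<Longrightarrow> \<alpha> (g \<otimes>\<^bsub>G\<^esub> h) a = \<alpha> g (\<alpha> h a)"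
  using assms by (auto simp: isometric_action_def isometric_on_def)

lemma isometric_action_one:
  assumes "isometric_action G A d \<alpha>" and "a \<in> A"
  shows "\<alpha> \<one>\<^bsub>G\<^esub> a = a"
  using assms by (simp add: isometric_action_def)

lemma isometric_action_inv:
  assumes "group G" and \<alpha>: "isometric_action G A d \<alpha>" and "g \<in> carrier G" and "a \<in> A"
  shows "\<alpha> (inv\<^bsub>G\<^esub> g) (\<alpha> g a) = a" and "\<alpha> g (\<alpha> (inv\<^bsub>G\<^esub> g) a) = a"
proof -
  interpret group G by fact
  show "\<alpha> (inv\<^bsub>G\<^esub> g) (\<alpha> g a) = a" "\<alpha> g (\<alpha> (inv\<^bsub>G\<^esub> g) a) = a"
    using assms isometric_action_one[OF \<alpha>] isometric_actionD(3)[OF \<alpha>]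
    by (metis inv_closed l_inv r_inv)+
qed

lemma isometric_action_isometry_group:
  "isometric_action (isometry_group F d) F d (\<lambda>g. g)"
  using Bij_imp_funcset
  by (auto simp: isometric_action_def isometry_group_def BijGroup_def compose_eq)

lemma finite_isometry_group:
  assumes "finite F"
  shows "finite (carrier (isometry_group F d))"
proof (rule finite_subset)
  show "carrier (isometry_group F d) \<subseteq> F \<rightarrow>\<^sub>E F"
    using Bij_imp_funcset by (auto simp: isometry_group_def Bij_def PiE_def)
  show "finite (F \<rightarrow>\<^sub>E F)"
    using assms by (intro finite_PiE) auto
qed

lemma isometric_action_restrict_hom:
  assumes "group G" and \<alpha>: "isometric_action G X d \<alpha>"
  shows "(\<lambda>g. restrict (\<alpha> g) X) \<in> hom G (isometry_group X d)"
proof -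
  interpret group G by fact
  have Bij: "restrict (\<alpha> g) X \<in> Bij X" if g: "g \<in> carrier G" for g
  proof -
    have "bij_betw (\<alpha> g) X X"
      by (rule bij_betwI[where g = "\<alpha> (inv\<^bsub>G\<^esub> g)"])
        (use g isometric_actionD(1)[OF \<alpha>] isometric_action_inv[OF assms g] in auto)
    then show ?thesis by (simp add: Bij_def)
  qed
  show ?thesis
  proof (rule homI)
    fix g h assume g: "g \<in> carrier G" and h: "h \<in> carrier G"
    show "restrict (\<alpha> g) X \<in> carrier (isometry_group X d)"
      using Bij[OF g] isometric_actionD(2)[OF \<alpha> g]
      by (simp add: isometry_group_def isometric_on_def)
    show "restrict (\<alpha> (g \<otimes>\<^bsub>G\<^esub> h)) X
        = restrict (\<alpha> g) X \<otimes>\<^bsub>isometry_group X d\<^esub> restrict (\<alpha> h) X"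
      using Bij[OF g] Bij[OF h] isometric_actionD(1)[OF \<alpha> h] isometric_actionD(3)[OF \<alpha> g h]
      by (auto simp: isometry_group_def BijGroup_def compose_def)
  qed
qed

text \<open>Transport of structure.\<close>

lemma isometric_action_transfer:
  assumes \<alpha>: "isometric_action G X dX \<alpha>" and iso: "isometric_on X dX d e" and inj: "inj_on e X"
  shows "isometric_action G (e ` X) d (\<lambda>g y. e (\<alpha> g (inv_into X e y)))"
proof -
  have "d (e p) (e q) = dX p q" if "p \<in> X" "q \<in> X" for p q
    using iso that by (simp add: isometric_on_def)
  with \<alpha> inj show ?thesis
    unfolding isometric_action_def isometric_on_def by (auto simp: Pi_iff)
qed

section \<open>Adding one orbit\<close>

text \<open>The free amalgam of the translates of \<open>x\<close>: the distance from the new point \<open>g\<close> to \<open>a\<close> is that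
  from \<open>x\<close> to \<open>g\<^sup>-\<^sup>1 a\<close>. Left translation permutes the paths through \<open>A\<close>, so it preserves their
  minimal length.\<close>

lemma isometric_action_amalgam:
  assumes "group G" and \<alpha>: "isometric_action G A d \<alpha>"
  shows "isometric_action G (A <+> carrier G) (amalgam_dist A d (\<lambda>g a. d x (\<alpha> (inv\<^bsub>G\<^esub> g) a)))
    (\<lambda>g. map_sum (\<alpha> g) ((\<otimes>\<^bsub>G\<^esub>) g))"
proof -
  interpret group G by fact
  let ?f = "\<lambda>g a. d x (\<alpha> (inv\<^bsub>G\<^esub> g) a)"
  note closed = isometric_actionD(1)[OF \<alpha>]
  have shift: "?f (g \<otimes>\<^bsub>G\<^esub> h) (\<alpha> g a) = ?f h a"
    if "g \<in> carrier G" "h \<in> carrier G" "a \<in> A" for g h a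
    using that closed isometric_actionD(3)[OF \<alpha>] isometric_action_inv(1)[OF assms]
    by (simp add: inv_mult_group)
  have image: "\<alpha> g ` A = A" if g: "g \<in> carrier G" for g
  proof
    show "\<alpha> g ` A \<subseteq> A" using closed[OF g] by auto
    show "A \<subseteq> \<alpha> g ` A"
      using closed[OF inv_closed[OF g]] isometric_action_inv(2)[OF assms g]
      by (metis image_eqI subsetI)
  qed
  have shift_Min: "(MIN a\<in>A. ?f (g \<otimes>\<^bsub>G\<^esub> h) a + ?f (g \<otimes>\<^bsub>G\<^esub> k) a) = (MIN a\<in>A. ?f h a + ?f k a)"
    if "g \<in> carrier G" "h \<in> carrier G" "k \<in> carrier G" for g h k
  proof -
    have "(\<lambda>a. ?f (g \<otimes>\<^bsub>G\<^esub> h) a + ?f (g \<otimes>\<^bsub>G\<^esub> k) a) ` A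
        = (\<lambda>a. ?f (g \<otimes>\<^bsub>G\<^esub> h) a + ?f (g \<otimes>\<^bsub>G\<^esub> k) a) ` \<alpha> g ` A"
      using image that by simp
    also have "\<dots> = (\<lambda>a. ?f h a + ?f k a) ` A"
      unfolding image_image using that by (intro image_cong) (simp_all add: shift)
    finally show ?thesis by simp
  qed
  show ?thesis
    unfolding isometric_action_def isometric_on_def
  proof (intro conjI ballI)
    fix g p q assume g: "g \<in> carrier G" and "p \<in> A <+> carrier G" "q \<in> A <+> carrier G"
    then show "amalgam_dist A d ?f (map_sum (\<alpha> g) ((\<otimes>\<^bsub>G\<^esub>) g) p) (map_sum (\<alpha> g) ((\<otimes>\<^bsub>G\<^esub>) g) q)
        = amalgam_dist A d ?f p q"
      by (elim PlusE) (simp_all add: isometric_actionD(2)[OF \<alpha>] shift shift_Min)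
  next
    fix p assume "p \<in> A <+> carrier G"
    then show "map_sum (\<alpha> \<one>\<^bsub>G\<^esub>) ((\<otimes>\<^bsub>G\<^esub>) \<one>\<^bsub>G\<^esub>) p = p"
      by (elim PlusE) (simp_all add: isometric_action_one[OF \<alpha>])
  next
    fix g h p assume "g \<in> carrier G" "h \<in> carrier G" "p \<in> A <+> carrier G"
    then show "map_sum (\<alpha> (g \<otimes>\<^bsub>G\<^esub> h)) ((\<otimes>\<^bsub>G\<^esub>) (g \<otimes>\<^bsub>G\<^esub> h)) p
        = map_sum (\<alpha> g) ((\<otimes>\<^bsub>G\<^esub>) g) (map_sum (\<alpha> h) ((\<otimes>\<^bsub>G\<^esub>) h) p)"
      by (elim PlusE) (simp_all add: isometric_actionD(3)[OF \<alpha>] m_assoc)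
  qed (auto simp: closed)
qed

lemma (in rational_urysohn) isometric_action_add_point:
  assumes "group G" and "finite (carrier G)"
    and A: "finite A" "A \<noteq> {}" "A \<subseteq> M" and \<alpha>: "isometric_action G A d \<alpha>" and "x \<in> M"
  shows "\<exists>B \<beta>. finite B \<and> B \<subseteq> M \<and> insert x A \<subseteq> B \<and> isometric_action G B d \<beta>
    \<and> (\<forall>g\<in>carrier G. \<forall>a\<in>A. \<beta> g a = \<alpha> g a)"
proof (cases "x \<in> A")
  case True
  with A \<alpha> show ?thesis by (intro exI[of _ A] exI[of _ \<alpha>]) auto
next
  case False
  interpret G: group G by fact
  define f where "f = (\<lambda>g a. d x (\<alpha> (inv\<^bsub>G\<^esub> g) a))"
  let ?X = "A <+> carrier G" and ?D = "amalgam_dist A d f"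
    and ?act = "\<lambda>g. map_sum (\<alpha> g) ((\<otimes>\<^bsub>G\<^esub>) g)"
  have in_A: "\<alpha> (inv\<^bsub>G\<^esub> g) a \<in> A" if "g \<in> carrier G" "a \<in> A" for g a
    using that isometric_actionD(1)[OF \<alpha>] by simp
  have in_M: "\<alpha> (inv\<^bsub>G\<^esub> g) a \<in> M" if "g \<in> carrier G" "a \<in> A" for g a
    using in_A[OF that] A(3) by blast
  have inv_dist: "d (\<alpha> (inv\<^bsub>G\<^esub> g) a) (\<alpha> (inv\<^bsub>G\<^esub> g) b) = d a b"
    if "g \<in> carrier G" "a \<in> A" "b \<in> A" for g a b
    using that isometric_actionD(2)[OF \<alpha>] by simp
  have metric: "Metric_space ?X ?D"
  proof (rule Metric_space_amalgam)
    show "Metric_space A d" using A(3) by (rule subspace)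
    fix g a assume ga: "g \<in> carrier G" "a \<in> A"
    show "0 < f g a"
      using in_A[OF ga] in_M[OF ga] False \<open>x \<in> M\<close> unfolding f_def by (metis mdist_pos_less)
    fix b assume b: "b \<in> A"
    show "f g a \<le> d a b + f g b"
      using triangle[OF \<open>x \<in> M\<close> in_M[OF ga(1) b] in_M[OF ga]] inv_dist[OF ga(1) b ga(2)]
      by (simp add: f_def commute[of a b])
    show "d a b \<le> f g a + f g b"
      using triangle[OF in_M[OF ga] \<open>x \<in> M\<close> in_M[OF ga(1) b]] inv_dist[OF ga b]
      by (simp add: f_def commute[of _ x])
  qed (use A in \<open>auto simp: f_def\<close>)
  let ?S = "insert (Inr \<one>\<^bsub>G\<^esub>) (Inl ` A)" and ?h = "case_sum (\<lambda>a. a) (\<lambda>_. x)"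
  have "\<exists>e. e \<in> ?X \<rightarrow> M \<and> isometric_on ?X ?D d e \<and> (\<forall>s\<in>?S. e s = ?h s)"
  proof (rule isometric_embedding_extends[OF metric])
    show "finite ?X" using A(1) \<open>finite (carrier G)\<close> by simp
    show "?D p q \<in> \<rat>" if "p \<in> ?X" "q \<in> ?X" for p q
    proof (rule amalgam_dist_rational[OF A(1,2) _ _ that])
      show "d a b \<in> \<rat>" if "a \<in> A" "b \<in> A" for a b
        using that A(3) rational by blast
      show "f g a \<in> \<rat>" if "g \<in> carrier G" "a \<in> A" for g a
        unfolding f_def using rational[OF \<open>x \<in> M\<close> in_M[OF that]] .
    qed
    show "?S \<subseteq> ?X" by auto
    show "?h \<in> ?S \<rightarrow> M" using A(3) \<open>x \<in> M\<close> by auto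
    show "isometric_on ?S ?D d ?h"
      using A(3) \<open>x \<in> M\<close> isometric_action_one[OF \<alpha>]
      by (auto simp: isometric_on_def f_def commute)
  qed
  then obtain e where e: "e \<in> ?X \<rightarrow> M" "isometric_on ?X ?D d e"
    and e_Inl: "\<And>a. a \<in> A \<Longrightarrow> e (Inl a) = a" and e_Inr: "e (Inr \<one>\<^bsub>G\<^esub>) = x"
    by auto
  have inj: "inj_on e ?X"
    using isometric_on_inj_on[OF metric Metric_space_axioms e] .
  let ?\<beta> = "\<lambda>g y. e (?act g (inv_into ?X e y))"
  have "isometric_action G (e ` ?X) d ?\<beta>"
    using isometric_action_amalgam[OF \<open>group G\<close> \<alpha>, of x, folded f_def] e(2) inj
    by (rule isometric_action_transfer)
  moreover have "?\<beta> g a = \<alpha> g a" if "g \<in> carrier G" "a \<in> A" for g a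
  proof -
    have "inv_into ?X e a = Inl a"
      using inv_into_f_f[OF inj, of "Inl a"] that e_Inl by auto
    then show ?thesis
      using that e_Inl isometric_actionD(1)[OF \<alpha>] by simp
  qed
  moreover have "insert x A \<subseteq> e ` ?X"
  proof
    fix y assume "y \<in> insert x A"
    then show "y \<in> e ` ?X"
      using e_Inl e_Inr by (metis G.one_closed InlI InrI image_eqI insertE)
  qed
  moreover have "finite (e ` ?X)" "e ` ?X \<subseteq> M"
    using A(1) \<open>finite (carrier G)\<close> e(1) by auto
  ultimately show ?thesis by blast
qed

section \<open>Extending the action to the whole space\<close>

text \<open>An action on the union of a chain is obtained from compatible actions on its members, since any
  two points lie in a common member.\<close>

lemma isometric_action_Union_chain:
  fixes A :: "nat \<Rightarrow> 'a set"
  assumes "group G"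
    and \<alpha>: "\<And>n. isometric_action G (A n) d (\<alpha> n)"
    and step: "\<And>n. A n \<subseteq> A (Suc n)"
    and agree_step: "\<And>n g a. \<lbrakk>g \<in> carrier G; a \<in> A n\<rbrakk> \<Longrightarrow> \<alpha> (Suc n) g a = \<alpha> n g a"
  shows "\<exists>\<beta>. isometric_action G (\<Union>n. A n) d \<beta> \<and> (\<forall>n. \<forall>g\<in>carrier G. \<forall>a\<in>A n. \<beta> g a = \<alpha> n g a)"
proof -
  interpret group G by fact
  have mono: "A m \<subseteq> A n" if "m \<le> n" for m n
    using that step by (rule lift_Suc_mono_le[rotated])
  have agree: "\<alpha> n g a = \<alpha> m g a" if "m \<le> n" "g \<in> carrier G" "a \<in> A m" for m n g a
    using that(1)
  proof (induction n rule: dec_induct)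
    case (step n)
    then have "a \<in> A n" using mono[OF step.hyps(1)] that(3) by blast
    with step.IH show ?case using agree_step[OF that(2)] by simp
  qed simp
  define \<beta> where "\<beta> g a = \<alpha> (LEAST n. a \<in> A n) g a" for g a
  have \<beta>: "\<beta> g a = \<alpha> n g a" if "g \<in> carrier G" "a \<in> A n" for n g a
    unfolding \<beta>_def using that by (metis agree Least_le LeastI)
  have common: "\<exists>n. a \<in> A n \<and> b \<in> A n" if "a \<in> (\<Union>n. A n)" "b \<in> (\<Union>n. A n)" for a b
  proof -
    from that obtain m n where "a \<in> A m" "b \<in> A n" by blast
    then show ?thesis
      using mono[of m "max m n"] mono[of n "max m n"] by (intro exI[of _ "max m n"]) auto
  qed
  have "isometric_action G (\<Union>n. A n) d \<beta>"
    unfolding isometric_action_def isometric_on_def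
  proof (intro conjI ballI)
    fix g assume g: "g \<in> carrier G"
    show "\<beta> g \<in> (\<Union>n. A n) \<rightarrow> (\<Union>n. A n)"
    proof
      fix a assume "a \<in> (\<Union>n. A n)"
      then obtain n where "a \<in> A n" by blast
      then show "\<beta> g a \<in> (\<Union>n. A n)"
        using \<beta>[OF g, of a n] isometric_actionD(1)[OF \<alpha> g] by auto
    qed
    fix a b assume "a \<in> (\<Union>n. A n)" "b \<in> (\<Union>n. A n)"
    then obtain n where "a \<in> A n" "b \<in> A n" using common by blast
    then show "d (\<beta> g a) (\<beta> g b) = d a b"
      using \<beta>[OF g] isometric_actionD(2)[OF \<alpha> g] by simp
  next
    fix a assume "a \<in> (\<Union>n. A n)"
    then obtain n where "a \<in> A n" by blast
    then show "\<beta> \<one>\<^bsub>G\<^esub> a = a"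
      using \<beta>[of _ _ n] isometric_action_one[OF \<alpha>] by simp
  next
    fix g h a assume g: "g \<in> carrier G" and h: "h \<in> carrier G" and "a \<in> (\<Union>n. A n)"
    then obtain n where "a \<in> A n" by blast
    then show "\<beta> (g \<otimes>\<^bsub>G\<^esub> h) a = \<beta> g (\<beta> h a)"
      using \<beta>[of _ _ n] g h isometric_actionD(1,3)[OF \<alpha>] by simp
  qed
  with \<beta> show ?thesis by blast
qed

lemma (in rational_urysohn) isometric_action_extends:
  assumes "group G" and "finite (carrier G)"
    and F: "finite F" "F \<noteq> {}" "F \<subseteq> M" and \<alpha>: "isometric_action G F d \<alpha>"
  shows "\<exists>\<beta>. isometric_action G M d \<beta> \<and> (\<forall>g\<in>carrier G. \<forall>a\<in>F. \<beta> g a = \<alpha> g a)"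
proof -
  define P where "P = (\<lambda>(A, \<gamma>). finite A \<and> F \<subseteq> A \<and> A \<subseteq> M \<and> isometric_action G A d \<gamma>
    \<and> (\<forall>g\<in>carrier G. \<forall>a\<in>F. \<gamma> g a = \<alpha> g a))"
  define Q :: "nat \<Rightarrow> 'a set \<times> ('b \<Rightarrow> 'a \<Rightarrow> 'a) \<Rightarrow> 'a set \<times> ('b \<Rightarrow> 'a \<Rightarrow> 'a) \<Rightarrow> bool"
    where "Q = (\<lambda>n (A, \<gamma>) (B, \<delta>). insert (from_nat_into M n) A \<subseteq> B
    \<and> (\<forall>g\<in>carrier G. \<forall>a\<in>A. \<delta> g a = \<gamma> g a))"
  have "M \<noteq> {}" using F by blast
  have "\<exists>s. \<forall>n. P (s n) \<and> Q n (s n) (s (Suc n))"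
  proof (rule dependent_nat_choice)
    show "\<exists>p. P p" using F \<alpha> by (intro exI[of _ "(F, \<alpha>)"]) (simp add: P_def)
    fix p n assume "P p"
    then obtain A \<gamma> where p: "p = (A, \<gamma>)" and A: "finite A" "F \<subseteq> A" "A \<subseteq> M"
      and \<gamma>: "isometric_action G A d \<gamma>" "\<forall>g\<in>carrier G. \<forall>a\<in>F. \<gamma> g a = \<alpha> g a"
      by (auto simp: P_def)
    have "A \<noteq> {}" using A(2) F(2) by blast
    from isometric_action_add_point
      [OF assms(1,2) A(1) this A(3) \<gamma>(1) from_nat_into[OF \<open>M \<noteq> {}\<close>, of n]]
    obtain B \<delta> where "finite B" "B \<subseteq> M" "insert (from_nat_into M n) A \<subseteq> B"
      "isometric_action G B d \<delta>" "\<forall>g\<in>carrier G. \<forall>a\<in>A. \<delta> g a = \<gamma> g a"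
      by (elim exE conjE) (rule that)
    with A \<gamma> have "P (B, \<delta>) \<and> Q n p (B, \<delta>)"
      by (auto simp: P_def Q_def p subset_iff)
    then show "\<exists>q. P q \<and> Q n p q" by blast
  qed
  then obtain s where s: "\<And>n. P (s n)" "\<And>n. Q n (s n) (s (Suc n))" by blast
  define A \<gamma> where "A n = fst (s n)" and "\<gamma> n = snd (s n)" for n
  have s_eq: "s n = (A n, \<gamma> n)" for n by (simp add: A_def \<gamma>_def)
  have "M \<subseteq> (\<Union>n. A n)"
  proof
    fix x assume "x \<in> M"
    then obtain n where "x = from_nat_into M n"
      using from_nat_into_surj[OF countable] by metis
    then have "x \<in> A (Suc n)" using s(2)[of n] by (simp add: Q_def s_eq)
    then show "x \<in> (\<Union>n. A n)" by blast
  qed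
  moreover have "(\<Union>n. A n) \<subseteq> M" using s(1) by (auto simp: P_def s_eq)
  ultimately have M: "(\<Union>n. A n) = M" by blast
  have "\<exists>\<beta>. isometric_action G (\<Union>n. A n) d \<beta>
      \<and> (\<forall>n. \<forall>g\<in>carrier G. \<forall>a\<in>A n. \<beta> g a = \<gamma> n g a)"
    using s by (intro isometric_action_Union_chain[OF \<open>group G\<close>]) (simp_all add: P_def Q_def s_eq)
  then obtain \<beta> where "isometric_action G M d \<beta>"
    and \<beta>: "\<And>n g a. \<lbrakk>g \<in> carrier G; a \<in> A n\<rbrakk> \<Longrightarrow> \<beta> g a = \<gamma> n g a"
    unfolding M by blast
  moreover have "\<beta> g a = \<alpha> g a" if "g \<in> carrier G" "a \<in> F" for g a
    using s(1)[of 0] \<beta>[of g a 0] that by (auto simp: P_def s_eq)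
  ultimately show ?thesis by blast
qed

section \<open>The homomorphism and its orbits\<close>

lemma finite_orbits_cover:
  assumes "finite H" and "H \<subseteq> carrier (isometry_group X d)" and "\<one>\<^bsub>isometry_group X d\<^esub> \<in> H"
    and "countable X"
  shows "\<exists>U. countable U \<and> U \<subseteq> orbits ((isometry_group X d)\<lparr>carrier := H\<rparr>) X (\<lambda>h. h)
    \<and> (\<forall>S\<in>U. finite S) \<and> X = \<Union>U"
proof (intro exI conjI)
  let ?orb = "orbit ((isometry_group X d)\<lparr>carrier := H\<rparr>) (\<lambda>h. h)"
  have orb: "?orb x = (\<lambda>h. h x) ` H" for x
    by (auto simp: orbit_def)
  show "countable (?orb ` X)" using assms(4) by simp
  show "?orb ` X \<subseteq> orbits ((isometry_group X d)\<lparr>carrier := H\<rparr>) X (\<lambda>h. h)"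
    by (auto simp: orbits_def)
  show "\<forall>S\<in>?orb ` X. finite S" using assms(1) by (simp add: orb)
  show "X = \<Union> (?orb ` X)"
  proof
    show "X \<subseteq> \<Union> (?orb ` X)"
    proof
      fix x assume x: "x \<in> X"
      then have "x = \<one>\<^bsub>isometry_group X d\<^esub> x"
        by (simp add: isometry_group_def BijGroup_def)
      then have "x \<in> ?orb x"
        unfolding orb using assms(3) by (rule image_eqI)
      with x show "x \<in> \<Union> (?orb ` X)" by blast
    qed
    have "h x \<in> X" if "h \<in> H" "x \<in> X" for h x
    proof -
      have "h \<in> Bij X" using assms(2) that(1) by (auto simp: isometry_group_def)
      then show ?thesis using Bij_imp_funcset that(2) by blast
    qed
    then show "\<Union> (?orb ` X) \<subseteq> X"
      unfolding orb by blast
  qed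
qed

text \<open>The empty set is treated apart, since two new points have no path through an empty set. Its
  isometry group is trivial.\<close>

lemma (in rational_urysohn) isometry_group_action_extends:
  assumes "finite F" and "F \<subseteq> M"
  shows "\<exists>\<beta>. isometric_action (isometry_group F d) M d \<beta>
    \<and> (\<forall>g\<in>carrier (isometry_group F d). \<forall>a\<in>F. \<beta> g a = g a)"
proof (cases "F = {}")
  case True
  then have "isometric_action (isometry_group F d) M d (\<lambda>_ a. a)"
    by (simp add: isometric_action_def isometric_on_def)
  with True show ?thesis by blast
next
  case False
  then show ?thesis
    using isometric_action_extends[OF group_isometry_group finite_isometry_group]
      isometric_action_isometry_group assms by blast
qed

theorem theorem1:
  fixes M :: "'a set" and d :: "'a \<Rightarrow> 'a \<Rightarrow> real" and F :: "'a set"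
  assumes "rational_urysohn M d"
    and "finite F" and "F \<subseteq> M"
  shows "\<exists>j. j \<in> hom (isometry_group F d) (isometry_group M d)
      \<and> inj_on j (carrier (isometry_group F d))
      \<and> (\<forall>g \<in> carrier (isometry_group F d). \<forall>f\<in>F. (j g) f = g f)
      \<and> (\<exists>U. countable U
            \<and> U \<subseteq> orbits ((isometry_group M d)\<lparr>carrier := j ` carrier (isometry_group F d)\<rparr>)
                     M (\<lambda>h. h)
            \<and> (\<forall>S\<in>U. finite S)
            \<and> M = \<Union>U)"
proof -
  interpret rational_urysohn M d by fact
  let ?G = "isometry_group F d"
  obtain \<beta> where \<beta>: "isometric_action ?G M d \<beta>"
    and \<beta>_F: "\<forall>g\<in>carrier ?G. \<forall>a\<in>F. \<beta> g a = g a"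
    using isometry_group_action_extends[OF assms(2,3)] by blast
  define j where "j = (\<lambda>g. restrict (\<beta> g) M)"
  have j: "j \<in> hom ?G (isometry_group M d)"
    unfolding j_def using group_isometry_group \<beta> by (rule isometric_action_restrict_hom)
  have j_F: "\<forall>g\<in>carrier ?G. \<forall>f\<in>F. j g f = g f"
    using \<beta>_F assms(3) by (auto simp: j_def)
  have "inj_on j (carrier ?G)"
  proof (rule inj_onI)
    fix g h assume gh: "g \<in> carrier ?G" "h \<in> carrier ?G" "j g = j h"
    then have "g \<in> extensional F" "h \<in> extensional F"
      by (auto simp: isometry_group_def Bij_def)
    moreover have "g x = h x" if "x \<in> F" for x
      using j_F gh that by metis
    ultimately show "g = h"
      by (rule extensionalityI)
  qed
  moreover have "\<exists>U. countable U
      \<and> U \<subseteq> orbits ((isometry_group M d)\<lparr>carrier := j ` carrier ?G\<rparr>) M (\<lambda>h. h)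
      \<and> (\<forall>S\<in>U. finite S) \<and> M = \<Union>U"
  proof (rule finite_orbits_cover)
    show "finite (j ` carrier ?G)"
      using finite_isometry_group[OF assms(2)] by (rule finite_imageI)
    show "j ` carrier ?G \<subseteq> carrier (isometry_group M d)"
      using j by (auto simp: hom_def)
    have "\<one>\<^bsub>?G\<^esub> \<in> carrier ?G"
      by (rule monoid.one_closed[OF group.is_monoid[OF group_isometry_group]])
    with hom_one[OF j group_isometry_group group_isometry_group, symmetric]
    show "\<one>\<^bsub>isometry_group M d\<^esub> \<in> j ` carrier ?G"
      by (rule image_eqI)
    show "countable M" by (rule countable)
  qed
  ultimately show ?thesis
    using j j_F by blast
qed

end
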